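(* Let $\alpha,\beta,a,b,c,z,p\in\mathbb{C}$ with $\mathrm{Re}(\alpha)>-1$, with $\mathrm{Re}(p)>0$ or $p=0$, with $|\arg(1-z)|<\pi$, and with $\mathrm{Re}(c)>\mathrm{Re}(b)>0$. Then the $\Psi$-Gauss hypergeometric function has the integral representations $${}^{\Psi}F_{p}^{(\alpha,\beta)}(a,b;c;z)=\frac{1}{B(b,c-b)}\int_{0}^{1}t^{b-1}(1-t)^{c-b-1}\;{}_{0}\Psi_{1}\left( \alpha,\beta;-\frac{p}{t(1-t)}\right)(1-zt)^{-a}dt,$$ $${}^{\Psi}F_{p}^{(\alpha,\beta)}(a,b;c;z)=\frac{1}{B(b,c-b)}\int_{0}^{\infty}u^{b-1}(1+u)^{a-c}\left[ 1+u(1-z)\right]^{-a}\;{}_{0}\Psi_{1}\left( \alpha,\beta;-2p-p\left( u+\frac{1}{u}\right) \right)du,$$ $${}^{\Psi}F_{p}^{(\alpha,\beta)}(a,b;c;z)=\frac{2}{B(b,c-b)}\int_{0}^{\frac{\pi}{2}} \sin^{2b-1}(\theta) \cos^{2c-2b-1}(\theta)\left( 1-z \sin^{2}(\theta)\right) ^{-a}\;{}_{0}\Psi_{1}\left( \alpha,\beta;-\frac{p}{ \sin^{2}(\theta) \cos^{2}(\theta)}\right)d\theta.$$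
   Context: For $\alpha,\beta\in\mathbb{C}$ with $\mathrm{Re}(\alpha)>-1$, the Wright function is ${}_{0}\Psi_{1}(\alpha,\beta;z)=\sum_{n=0}^{\infty}\frac{1}{\Gamma(\alpha n+\beta)}\frac{z^n}{n!}$ (with $1/\Gamma$ equal to $0$ at the poles of $\Gamma$). The $\Psi$-beta function is, for $\mathrm{Re}(x)>0$, $\mathrm{Re}(y)>0$ and $\mathrm{Re}(p)>0$ (or $p=0$, by the same formula), $${}^{\Psi}B_{p}^{(\alpha,\beta)}(x,y)=\int_{0}^{1}t^{x-1}(1-t)^{y-1}\,{}_{0}\Psi_{1}\left(\alpha,\beta;-\frac{p}{t(1-t)}\right)dt.$$ The $\Psi$-Gauss hypergeometric function is $${}^{\Psi}F_{p}^{(\alpha,\beta)}(a,b;c;z)=\sum_{n=0}^{\infty}(a)_{n}\frac{{}^{\Psi}B_{p}^{(\alpha,\beta)}(b+n,c-b)}{B(b,c-b)}\frac{z^{n}}{n!},$$ and for $z$ with $|\arg(1-z)|<\pi$ outside the disc of convergence it is understood as the analytic continuation of this series in $z$. Here $B$ is the classical beta function, $(a)_0=1$, $(a)_n=\Gamma(a+n)/\Gamma(a)=a(a+1)\cdots(a+n-1)$, and complex powers take principal values.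
   Formalization: It is additionally assumed that the Ψ-beta integral with parameters (b, c−b), the n=0 coefficient of the series, converges (possibly conditionally); under the stated conditions it can diverge, e.g. α=1, p=1+i, and then the Ψ-Gauss function is undefined. *)

theory Defs
  imports "HOL-Complex_Analysis.Complex_Analysis"
begin

definition Wright :: "complex \<Rightarrow> complex \<Rightarrow> complex \<Rightarrow> complex" where
  "Wright \<alpha> \<beta> z = (\<Sum>n. rGamma (\<alpha> * of_nat n + \<beta>) * z ^ n / fact n)"

definition Psi_Beta_integrand ::
    "complex \<Rightarrow> complex \<Rightarrow> complex \<Rightarrow> complex \<Rightarrow> complex \<Rightarrow> real \<Rightarrow> complex" where
  "Psi_Beta_integrand \<alpha> \<beta> p x y t =
     of_real t powr (x - 1) * of_real (1 - t) powr (y - 1) *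
     Wright \<alpha> \<beta> (- (p / of_real (t * (1 - t))))"

text \<open>
  Integrals are Henstock-Kurzweil integrals; over an interval they agree with (possibly only
  conditionally convergent) improper integrals whenever the latter exist. The integral below does
  not exist for all parameters with \<open>Re p > 0\<close>: for \<open>\<alpha> = 1\<close> the Wright function is of Bessel
  type and the integrand grows exponentially at both endpoints when \<open>p\<close> is not real.
\<close>

definition Psi_Beta_exists ::
    "complex \<Rightarrow> complex \<Rightarrow> complex \<Rightarrow> complex \<Rightarrow> complex \<Rightarrow> bool" where
  "Psi_Beta_exists \<alpha> \<beta> p x y \<longleftrightarrow> Psi_Beta_integrand \<alpha> \<beta> p x y integrable_on {0<..<1}"

definition Psi_Beta ::
    "complex \<Rightarrow> complex \<Rightarrow> complex \<Rightarrow> complex \<Rightarrow> complex \<Rightarrow> complex" where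
  "Psi_Beta \<alpha> \<beta> p x y = integral {0<..<1} (Psi_Beta_integrand \<alpha> \<beta> p x y)"

definition Psi_Gauss_term ::
    "complex \<Rightarrow> complex \<Rightarrow> complex \<Rightarrow> complex \<Rightarrow> complex \<Rightarrow> complex \<Rightarrow> complex \<Rightarrow> nat \<Rightarrow> complex" where
  "Psi_Gauss_term \<alpha> \<beta> p a b c z n =
     pochhammer a n * (Psi_Beta \<alpha> \<beta> p (b + of_nat n) (c - b) / Beta b (c - b)) * (z ^ n / fact n)"

text \<open>
  The domain \<open>|arg (1 - z)| < \<pi>\<close>. Since \<open>Arg 0 = 0\<close> in the library, the point
  \<open>z = 1\<close>, where the argument is undefined, has to be excluded explicitly.
\<close>

definition cut_plane :: "complex set" where
  "cut_plane = {z. z \<noteq> 1 \<and> \<bar>Arg (1 - z)\<bar> < pi}"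

text \<open>
  Outside the unit disc, the value is that of the analytic continuation of the series to the
  cut plane, which is unique because the cut plane is connected.
\<close>

definition Psi_Gauss ::
    "complex \<Rightarrow> complex \<Rightarrow> complex \<Rightarrow> complex \<Rightarrow> complex \<Rightarrow> complex \<Rightarrow> complex \<Rightarrow> complex" where
  "Psi_Gauss \<alpha> \<beta> p a b c z =
     (if norm z < 1 then (\<Sum>n. Psi_Gauss_term \<alpha> \<beta> p a b c z n)
      else (THE w. \<exists>g. g holomorphic_on cut_plane \<and>
              (\<forall>\<zeta>. norm \<zeta> < 1 \<longrightarrow> Psi_Gauss_term \<alpha> \<beta> p a b c \<zeta> sums g \<zeta>) \<and> w = g z))"

end

theory Submission
  imports Defs "HOL-Real_Asymp.Real_Asymp"
begin

text \<open>
  Write \<open>\<phi>\<close> for the integrand of the \<open>\<Psi>\<close>-beta integral with parameters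
  \<open>(b, c - b)\<close>. Shifting the first parameter by \<open>n\<close> multiplies the integrand by \<open>t ^ n\<close>, so
  inside the unit disc the first representation is the binomial series of \<open>(1 - z t) powr (- a)\<close>
  integrated term by term against \<open>\<phi>\<close>. Outside the disc it holds because the Euler integral is
  holomorphic in \<open>z\<close> on the cut plane, which is connected, so that it is the analytic
  continuation of the series. The other two representations arise from the substitutions
  \<open>t = u / (1 + u)\<close> and \<open>t = (sin \<theta>)\<^sup>2\<close>.

  The difficulty is that \<open>\<phi>\<close> may be integrable only conditionally, so that neither dominated
  convergence nor a change of variables for absolutely integrable functions applies. The remedy
  is the continuous primitive \<open>\<Phi> t = integral {0..t} \<phi>\<close>. Integration by parts turns an
  integral of \<open>\<phi> * g\<close>, for a continuously differentiable \<open>g\<close>, into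
  \<open>\<Phi> 1 * g 1 - integral {0..1} (\<Phi> * g')\<close> (\<open>has_integral_by_parts_conditional\<close>), and here all
  integrands are continuous on a compact interval: uniform convergence of the derivatives gives
  the termwise integration (\<open>integral_kernel_sums\<close>), and the Leibniz rule gives holomorphy
  (\<open>integral_kernel_holomorphic\<close>). The substitutions likewise reduce to the fundamental theorem
  of calculus for \<open>\<Phi>\<close> composed with the substitution.

  For \<open>\<Phi>\<close> to be a pointwise primitive, \<open>\<phi>\<close> must be continuous in the open interval, hence the
  Wright series must define a continuous function. This is where \<open>Re \<alpha> > -1\<close> enters:
  \<open>1 / \<Gamma>(\<alpha> n + \<beta>)\<close> grows at most like \<open>n powr (s * n)\<close> times a geometric factor for some
  \<open>s < 1\<close>, which is beaten by \<open>fact n\<close> (\<open>summable_Wright\<close>).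
\<close>

section \<open>The Wright function is entire\<close>

lemma norm_pochhammer_ge:
  fixes z :: complex
  assumes "Re z > 0"
  shows "norm (pochhammer z n) \<ge> pochhammer (Re z) n"
proof -
  have "(\<Prod>i=0..<n. Re z + of_nat i) \<le> (\<Prod>i=0..<n. norm (z + of_nat i))"
  proof (rule prod_mono, safe)
    fix i
    show "0 \<le> Re z + of_nat i" using assms by simp
    show "Re z + of_nat i \<le> norm (z + of_nat i)"
      using complex_Re_le_cmod[of "z + of_nat i"] by simp
  qed
  thus ?thesis by (simp add: pochhammer_prod prod_norm)
qed

text \<open>
  Both sides are limits of Euler's product quotients. In these the numerator has the same modulus
  for \<open>z\<close> and \<open>Re z\<close>, and every factor of the denominator is smaller for \<open>Re z\<close>.
\<close>

lemma norm_Gamma_le: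
  fixes z :: complex
  assumes "Re z > 0"
  shows "norm (Gamma z) \<le> Gamma (Re z)"
proof (rule LIMSEQ_le)
  show "(\<lambda>n. norm (Gamma_series z n)) \<longlonglongrightarrow> norm (Gamma z)"
    by (intro tendsto_norm Gamma_series_LIMSEQ)
  show "Gamma_series (Re z) \<longlonglongrightarrow> Gamma (Re z)"
    by (rule Gamma_series_LIMSEQ)
  have "norm (Gamma_series z n) \<le> Gamma_series (Re z) n" for n
  proof -
    have pos: "pochhammer (Re z) (n + 1) > 0" using assms by (rule pochhammer_pos)
    have "norm (Gamma_series z n) =
            fact n * exp (Re z * ln (of_nat n)) / norm (pochhammer z (n + 1))"
      by (simp add: Gamma_series_def norm_mult norm_divide)
    also have "\<dots> \<le> fact n * exp (Re z * ln (of_nat n)) / pochhammer (Re z) (n + 1)"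
      using pos norm_pochhammer_ge[OF assms, of "n+1"] 
      by (intro divide_left_mono mult_pos_pos) auto
    finally show ?thesis by (simp add: Gamma_series_def)
  qed
  thus "\<exists>N. \<forall>n\<ge>N. norm (Gamma_series z n) \<le> Gamma_series (Re z) n" by blast
qed

text \<open>
  On \<open>[1, 2]\<close> log-convexity gives \<open>Gamma x \<le> 1\<close>, because \<open>Gamma 1 = Gamma 2 = 1\<close>; the
  functional equation carries the bound to the right.
\<close>

lemma Gamma_le_powr_self:
  fixes x :: real
  assumes "x \<ge> 1"
  shows "Gamma x \<le> x powr x"
proof -
  have base: "Gamma y \<le> 1" if "y \<ge> 1" "y \<le> 2" for y :: real
  proof -
    have "(ln \<circ> Gamma) ((1 - (y - 1)) *\<^sub>R (1::real) + (y - 1) *\<^sub>R (2::real)) \<le>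
          (1 - (y - 1)) * (ln \<circ> Gamma) (1::real) + (y - 1) * (ln \<circ> Gamma) (2::real)"
      using that by (intro convex_onD[OF log_convex_Gamma_real]) auto
    moreover have "Gamma (2::real) = 1" using Gamma_fact[of 1, where 'a = real] by simp
    ultimately have "ln (Gamma y) \<le> 0" by (simp add: algebra_simps)
    thus ?thesis using Gamma_real_pos[of y] that by simp
  qed
  have "\<forall>x::real. 1 \<le> x \<and> x \<le> 2 + of_nat n \<longrightarrow> Gamma x \<le> x powr x" for n
  proof (induction n)
    case 0
    show ?case
    proof safe
      fix x :: real assume x: "1 \<le> x" "x \<le> 2 + of_nat 0"
      have "1 powr x \<le> x powr x" using x by (intro powr_mono2) auto
      with base[of x] x show "Gamma x \<le> x powr x" by simp
    qed
  next
    case (Suc n)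
    show ?case
    proof safe
      fix x :: real assume x: "1 \<le> x" "x \<le> 2 + of_nat (Suc n)"
      show "Gamma x \<le> x powr x"
      proof (cases "x \<le> 2")
        case True
        have "1 powr x \<le> x powr x" using x by (intro powr_mono2) auto
        with base[of x] x True show ?thesis by simp
      next
        case False
        have "Gamma x = (x - 1) * Gamma (x - 1)"
          using Gamma_plus1[of "x - 1"] False by (simp add: nonpos_Ints_def)
        also have "\<dots> \<le> (x - 1) * (x - 1) powr (x - 1)"
          using Suc[rule_format, of "x-1"] False x by (intro mult_left_mono) auto
        also have "\<dots> = (x - 1) powr x"
          using False by (simp add: powr_mult_base)
        also have "\<dots> \<le> x powr x" using False by (intro powr_mono2) auto
        finally show ?thesis .
      qed
    qed
  qed
  moreover obtain n where "x \<le> real n" using real_arch_simple by blast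
  ultimately show ?thesis using assms by (metis add_increasing zero_le_numeral)
qed

text \<open>
  In the left half-plane the reflection formula expresses \<open>rGamma z\<close> through the sine, which
  contributes the exponential factor, and through \<open>Gamma (1 - z)\<close>.
\<close>

lemma norm_rGamma_le_left:
  fixes z :: complex
  assumes "Re z \<le> 0"
  shows "norm (rGamma z) \<le> exp (pi * norm z) * Gamma (1 - Re z)"
proof -
  have "1 - z \<notin> \<int>\<^sub>\<le>\<^sub>0"
  proof
    assume "1 - z \<in> \<int>\<^sub>\<le>\<^sub>0"
    then obtain n where n: "1 - z = of_int n" "n \<le> 0" by (auto elim!: nonpos_Ints_cases)
    hence "Re (1 - z) \<le> 0" by (simp only: n(1)) simp
    thus False using assms by simp
  qed
  hence nz: "Gamma (1 - z) \<noteq> 0" by (simp add: Gamma_eq_zero_iff)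
  have "rGamma z * rGamma (1 - z) = sin (of_real pi * z) / of_real pi"
    by (rule rGamma_reflection_complex)
  hence eq: "rGamma z = sin (of_real pi * z) / of_real pi * Gamma (1 - z)"
    using nz by (simp add: Gamma_def field_simps)
  have "norm (sin (of_real pi * z)) \<le> exp \<bar>Im (of_real pi * z)\<bar>"
    using cmod_sin_le_exp[of 1 "of_real pi * z"] by simp
  also have "\<dots> \<le> exp (pi * norm z)"
    using abs_Im_le_cmod[of z] by (simp add: abs_mult)
  finally have s: "norm (sin (of_real pi * z)) / pi \<le> exp (pi * norm z) / 1"
    using pi_gt3 by (intro frac_le) auto
  have "norm (rGamma z) = norm (sin (of_real pi * z)) / pi * norm (Gamma (1 - z))"
    by (simp add: eq norm_mult norm_divide)
  also have "\<dots> \<le> exp (pi * norm z) / 1 * Gamma (1 - Re z)"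
    using norm_Gamma_le[of "1 - z"] assms by (intro mult_mono s) auto
  finally show ?thesis by simp
qed

text \<open>
  For \<open>Re z > 2\<close> a step to the left by the functional equation only increases the modulus, so the
  strip \<open>0 \<le> Re z \<le> 2\<close> decides. There the part near the real axis is compact, and elsewhere two
  steps to the left reach the half-plane of \<open>norm_rGamma_le_left\<close>; the factors picked
  up have modulus at least 1 because \<open>\<bar>Im z\<bar> > 1\<close>.
\<close>

lemma norm_rGamma_le_right:
  obtains M :: real where "M \<ge> 1" "\<And>z. Re z \<ge> 0 \<Longrightarrow> norm (rGamma z) \<le> M * exp (pi * norm z)"
proof -
  define K where "K = cbox (Complex 0 (-1)) (Complex 2 1)"
  have "compact (rGamma ` K)"
    unfolding K_def by (intro compact_continuous_image continuous_intros) auto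
  then obtain B where B: "\<And>z. z \<in> K \<Longrightarrow> norm (rGamma z) \<le> B"
    unfolding bounded_iff by (metis compact_imp_bounded bounded_iff imageI)
  define M where "M = max B (exp (pi * 2) * 27)"
  have M: "M \<ge> B" "M \<ge> exp (pi * 2) * 27" by (simp_all add: M_def)
  have M1: "M \<ge> 1" using M(2) one_le_exp_iff[of "pi * 2"] pi_gt_zero by linarith
  have base: "norm (rGamma z) \<le> M * exp (pi * norm z)" if z: "Re z \<ge> 0" "Re z \<le> 2" for z
  proof (cases "\<bar>Im z\<bar> \<le> 1")
    case True
    hence "z \<in> K" using z by (auto simp: K_def in_cbox_complex_iff abs_le_iff)
    hence "norm (rGamma z) \<le> M * 1" using B[of z] M by simp
    also have "\<dots> \<le> M * exp (pi * norm z)" using M1 by (intro mult_left_mono) auto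
    finally show ?thesis .
  next
    case False
    have 1: "norm (z - 1) \<ge> 1" "norm (z - 2) \<ge> 1"
      using False abs_Im_le_cmod[of "z - 1"] abs_Im_le_cmod[of "z - 2"] by auto
    have "rGamma (z - 2) = (z - 2) * ((z - 1) * rGamma z)"
      using rGamma_plus1[of "z - 2"] rGamma_plus1[of "z - 1"] by simp
    hence "norm (rGamma (z - 2)) = norm (z - 2) * norm (z - 1) * norm (rGamma z)"
      by (simp add: norm_mult)
    moreover have "1 * 1 * norm (rGamma z) \<le> norm (z - 2) * norm (z - 1) * norm (rGamma z)"
      using 1 by (intro mult_mono) auto
    ultimately have "norm (rGamma z) \<le> norm (rGamma (z - 2))" by simp
    also have "\<dots> \<le> exp (pi * norm (z - 2)) * Gamma (1 - Re (z - 2))"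
      using z by (intro norm_rGamma_le_left) auto
    also have "\<dots> \<le> exp (pi * (2 + norm z)) * 27"
    proof (intro mult_mono)
      show "exp (pi * norm (z - 2)) \<le> exp (pi * (2 + norm z))"
        using norm_triangle_ineq4[of z 2] by simp
      \<comment> \<open>The constant 27 is the value of \<open>x powr x\<close> at the largest possible argument 3.\<close>
      have "Gamma (1 - Re (z - 2)) \<le> (3 - Re z) powr (3 - Re z)"
        using Gamma_le_powr_self[of "3 - Re z"] z by simp
      also have "\<dots> \<le> 3 powr 3"
        using z by (intro order.trans[OF powr_mono powr_mono2]) auto
      finally show "Gamma (1 - Re (z - 2)) \<le> 27" by simp
    qed (use z in \<open>auto intro!: less_imp_le[OF Gamma_real_pos]\<close>)
    also have "\<dots> = exp (pi * 2) * 27 * exp (pi * norm z)"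
      by (simp add: algebra_simps exp_add)
    also have "\<dots> \<le> M * exp (pi * norm z)"
      using M(2) by (intro mult_right_mono) auto
    finally show ?thesis .
  qed
  have "\<forall>z. 0 \<le> Re z \<and> Re z \<le> 2 + of_nat n \<longrightarrow> norm (rGamma z) \<le> M * exp (pi * norm z)" for n
  proof (induction n)
    case 0
    thus ?case using base by auto
  next
    case (Suc n)
    show ?case
    proof safe
      fix z assume z: "0 \<le> Re z" "Re z \<le> 2 + of_nat (Suc n)"
      show "norm (rGamma z) \<le> M * exp (pi * norm z)"
      proof (cases "Re z \<le> 2")
        case True
        thus ?thesis using base z by auto
      next
        case False
        have "1 * norm (rGamma z) \<le> norm (z - 1) * norm (rGamma z)"
          using False abs_Re_le_cmod[of "z - 1"] by (intro mult_right_mono) auto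
        also have "\<dots> = norm (rGamma (z - 1))"
          using rGamma_plus1[of "z - 1"] by (simp flip: norm_mult)
        also have "\<dots> \<le> M * exp (pi * norm (z - 1))"
          using Suc[rule_format, of "z - 1"] False z by auto
        also have "\<dots> \<le> M * exp (pi * norm z)"
        proof -
          have "(Re z - 1)\<^sup>2 \<le> (Re z)\<^sup>2" using False by (intro power_mono) auto
          hence "norm (z - 1) \<le> norm z" by (simp add: cmod_def)
          thus ?thesis using M1 by (intro mult_left_mono) auto
        qed
        finally show ?thesis by simp
      qed
    qed
  qed
  note bound = this
  have "norm (rGamma z) \<le> M * exp (pi * norm z)" if "Re z \<ge> 0" for z
  proof -
    obtain n where "Re z \<le> real n" using real_arch_simple by blast
    thus ?thesis using bound[of n] that by simp
  qed
  thus ?thesis using M1 that by blast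
qed

text \<open>
  The two half-plane bounds in one form. Leaving \<open>x\<close> free allows a single choice, affine
  in \<open>n\<close>, for all arguments \<open>\<alpha> n + \<beta>\<close>.
\<close>

lemma norm_rGamma_le:
  obtains M :: real where "M \<ge> 1"
    "\<And>z x. x \<ge> 1 \<Longrightarrow> x \<ge> 1 - Re z \<Longrightarrow> norm (rGamma z) \<le> M * exp (pi * norm z) * x powr x"
proof -
  obtain M :: real where M: "M \<ge> 1" "\<And>z. Re z \<ge> 0 \<Longrightarrow> norm (rGamma z) \<le> M * exp (pi * norm z)"
    using norm_rGamma_le_right by blast
  have "norm (rGamma z) \<le> M * exp (pi * norm z) * x powr x" if x: "x \<ge> 1" "x \<ge> 1 - Re z" for z x
  proof (cases "Re z \<ge> 0")
    case True
    have "1 powr x \<le> x powr x" using x by (intro powr_mono2) auto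
    hence "M * exp (pi * norm z) * 1 \<le> M * exp (pi * norm z) * x powr x"
      using M(1) by (intro mult_left_mono) auto
    thus ?thesis using M(2)[OF True] by simp
  next
    case False
    have "(1 - Re z) powr (1 - Re z) \<le> x powr x"
      using x False by (intro order.trans[OF powr_mono powr_mono2]) auto
    hence "Gamma (1 - Re z) \<le> x powr x" using Gamma_le_powr_self[of "1 - Re z"] False by auto
    hence "1 * exp (pi * norm z) * Gamma (1 - Re z) \<le> M * exp (pi * norm z) * x powr x"
      using M(1) False by (intro mult_mono order.refl) (auto intro!: less_imp_le[OF Gamma_real_pos])
    thus ?thesis using norm_rGamma_le_left[of z] False by linarith
  qed
  thus ?thesis using M(1) that by blast
qed

lemma summable_powr_self_over_fact:
  fixes A s D :: real
  assumes "0 < s" "s < 1" "D \<ge> 1" "A > 0"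
  shows "summable (\<lambda>n. A ^ n * (s * n + D) powr (s * n + D) / fact n)"
proof -
  define b where "b = (\<lambda>n. A ^ n * (s * real n + D) powr (s * n + D) / fact n)"
  have pos: "s * real n + D > 0" for n
    using assms by (intro add_nonneg_pos) auto
  have bpos: "b n > 0" for n
    using assms pos[of n] by (auto simp: b_def intro!: divide_pos_pos mult_pos_pos add_nonneg_pos)
  \<comment> \<open>The ratio of consecutive terms behaves like a constant times \<open>n powr (s - 1)\<close>.\<close>
  have "(\<lambda>n. A / (real n + 1) * ((s * (real n + 1) + D) powr (s * (real n + 1) + D)
           / (s * real n + D) powr (s * real n + D))) \<longlonglongrightarrow> 0"
    using assms by real_asymp
  hence "eventually (\<lambda>n. A / (real n + 1) * ((s * (real n + 1) + D) powr (s * (real n + 1) + D)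
           / (s * real n + D) powr (s * real n + D)) < 1/2) sequentially"
    by (rule order_tendstoD) simp
  then obtain N where N: "\<And>n. n \<ge> N \<Longrightarrow>  A / (real n + 1) * ((s * (real n + 1) + D) powr (s * (real n + 1) + D)
           / (s * real n + D) powr (s * real n + D)) < 1/2"
    unfolding eventually_sequentially by blast
  have "summable b"
  proof (rule summable_ratio_test)
    show "(1/2::real) < 1" by simp
    fix n assume "n \<ge> N"
    have "b (Suc n) = b n * (A / (real n + 1) * ((s * (real n + 1) + D) powr (s * (real n + 1) + D)
           / (s * real n + D) powr (s * real n + D)))"
    proof -
      have "(s * real n + D) powr (s * real n + D) \<noteq> 0" using pos[of n] by simp
      moreover have "b (Suc n) = A ^ n * A * (s * (real n + 1) + D) powr (s * (real n + 1) + D)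
                                   / ((real n + 1) * fact n)"
        by (simp add: b_def algebra_simps)
      ultimately show ?thesis unfolding b_def by (simp add: divide_simps)
    qed
    also have "\<dots> \<le> b n * (1/2)"
      using N[OF \<open>n \<ge> N\<close>] bpos[of n] by (intro mult_left_mono) auto
    finally show "norm (b (Suc n)) \<le> 1 / 2 * norm (b n)" using bpos[of n] bpos[of "Suc n"] by simp
  qed
  thus ?thesis by (simp add: b_def)
qed

text \<open>
  The bound \<open>norm_rGamma_le\<close> is used with \<open>x = s * n + D\<close>, where \<open>- Re \<alpha> \<le> s < 1\<close>; such an \<open>s\<close>
  exists exactly because \<open>Re \<alpha> > -1\<close>. The lower bound \<open>1 / 2\<close> in the choice of \<open>s\<close> merely keeps it
  positive.
\<close>

lemma summable_Wright:
  assumes "Re \<alpha> > -1"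
  shows "summable (\<lambda>n. rGamma (\<alpha> * of_nat n + \<beta>) / fact n * w ^ n)"
proof -
  obtain M :: real where M: "M \<ge> 1"
    "\<And>z x. x \<ge> 1 \<Longrightarrow> x \<ge> 1 - Re z \<Longrightarrow> norm (rGamma z) \<le> M * exp (pi * norm z) * x powr x"
    using norm_rGamma_le by blast
  define s where "s = max (1/2) (- Re \<alpha>)"
  define D where "D = 1 + \<bar>Re \<beta>\<bar>"
  define A where "A = exp (pi * norm \<alpha>) * (norm w + 1)"
  have s: "0 < s" "s < 1" "s \<ge> - Re \<alpha>" using assms by (auto simp: s_def)
  have "D \<ge> 1" by (simp add: D_def)
  have "A > 0" by (auto simp: A_def intro!: mult_pos_pos add_nonneg_pos)
  have "summable (\<lambda>n. M * exp (pi * norm \<beta>) * (A ^ n * (s * n + D) powr (s * n + D) / fact n))"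
    by (intro summable_mult summable_powr_self_over_fact) fact+
  thus ?thesis
  proof (rule summable_comparison_test'[where N = 0])
    fix n :: nat
    let ?z = "\<alpha> * of_nat n + \<beta>" and ?x = "s * real n + D"
    have "- Re \<alpha> * real n \<le> s * real n" using s by (intro mult_right_mono) auto
    hence "norm (rGamma ?z) \<le> M * exp (pi * norm ?z) * ?x powr ?x"
      using s \<open>D \<ge> 1\<close> by (intro M(2)) (auto simp: D_def)
    also have "\<dots> \<le> M * exp (pi * (norm \<alpha> * n + norm \<beta>)) * ?x powr ?x"
      using M(1) norm_triangle_ineq[of "\<alpha> * of_nat n" \<beta>]
      by (intro mult_right_mono mult_left_mono) (auto simp: norm_mult)
    also have "exp (pi * (norm \<alpha> * n + norm \<beta>)) = exp (pi * norm \<alpha>) ^ n * exp (pi * norm \<beta>)"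
      by (simp add: exp_add algebra_simps flip: exp_of_nat_mult)
    finally have 1: "norm (rGamma ?z) \<le>
        M * (exp (pi * norm \<alpha>) ^ n * exp (pi * norm \<beta>)) * ?x powr ?x" .
    have "norm (rGamma ?z / fact n * w ^ n) = norm (rGamma ?z) * norm w ^ n / fact n"
      by (simp add: norm_mult norm_divide norm_power)
    also have "\<dots> \<le> M * (exp (pi * norm \<alpha>) ^ n * exp (pi * norm \<beta>)) * ?x powr ?x *
                     (norm w + 1) ^ n / fact n"
      using M(1) by (intro divide_right_mono mult_mono 1 power_mono) auto
    finally show "norm (rGamma ?z / fact n * w ^ n) \<le>
        M * exp (pi * norm \<beta>) * (A ^ n * ?x powr ?x / fact n)"
      by (simp add: A_def power_mult_distrib mult_ac)
  qed
qed

lemma continuous_on_Wright: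
  assumes "Re \<alpha> > -1"
  shows "continuous_on S (Wright \<alpha> \<beta>)"
proof -
  have "isCont (\<lambda>w. \<Sum>n. rGamma (\<alpha> * of_nat n + \<beta>) / fact n * w ^ n) w" for w
    by (rule isCont_powser_converges_everywhere) (rule summable_Wright[OF assms])
  thus ?thesis
    unfolding Wright_def by (auto intro!: continuous_at_imp_continuous_on)
qed

section \<open>Conditionally convergent integrals\<close>

text \<open>
  The gauge integral over an unbounded set is by definition the limit of the integrals over large
  boxes, so that the convergence of the primitive at infinity suffices.
\<close>

lemma has_integral_Ioi_FTC:
  fixes F :: "real \<Rightarrow> 'a :: banach"
  assumes cont: "continuous_on {c..} F"
    and deriv: "\<And>x. x > c \<Longrightarrow> (F has_vector_derivative f x) (at x)"
    and lim: "(F \<longlongrightarrow> L) at_top"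
  shows "(f has_integral (L - F c)) {c<..}"
proof (subst has_integral', intro allI impI)
  fix e :: real assume "e > 0"
  with lim have "eventually (\<lambda>x. dist (F x) L < e) at_top" by (rule tendstoD)
  then obtain X where X: "\<And>x. x \<ge> X \<Longrightarrow> dist (F x) L < e"
    unfolding eventually_at_top_linorder by blast
  define R where "R = max \<bar>X\<bar> \<bar>c\<bar>"
  have R: "R \<ge> X" "R \<ge> c" "- R \<le> c" "R \<ge> 0" by (auto simp: R_def)
  have "\<exists>z. ((\<lambda>x. if x \<in> {c<..} then f x else 0) has_integral z) (cbox a b) \<and>
              norm (z - (L - F c)) < e" if ab: "ball 0 (R + 1) \<subseteq> cbox a b" for a b
  proof -
    have "R \<in> ball 0 (R + 1)" "- R \<in> ball 0 (R + 1)" using R by auto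
    with ab have "R \<in> cbox a b" "- R \<in> cbox a b" by blast+
    hence "a \<le> - R" "R \<le> b" by auto
    hence b: "a \<le> c" "c \<le> b" "X \<le> b" using R by auto
    have "(f has_integral (F b - F c)) {c..b}"
      using b deriv by (intro fundamental_theorem_of_calculus_interior
                          continuous_on_subset[OF cont]) auto
    moreover have "negligible {x \<in> {c..b} - {c<..b}. f x \<noteq> 0}"
                  "negligible {x \<in> {c<..b} - {c..b}. f x \<noteq> 0}"
      by (auto intro: negligible_subset[of "{c}"])
    ultimately have "(f has_integral (F b - F c)) {c<..b}"
      by (subst (asm) has_integral_spike_set_eq) auto
    also have "{c<..b} = {c<..} \<inter> {a..b}" using b by auto
    finally have "((\<lambda>x. if x \<in> {c<..} then f x else 0) has_integral (F b - F c)) (cbox a b)"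
      by (subst has_integral_restrict_Int) simp
    moreover have "norm (F b - F c - (L - F c)) < e"
      using X[OF b(3)] by (simp add: dist_norm)
    ultimately show ?thesis by blast
  qed
  thus "\<exists>B>0. \<forall>a b. ball 0 B \<subseteq> cbox a b \<longrightarrow>
          (\<exists>z. ((\<lambda>x. if x \<in> {c<..} then f x else 0) has_integral z) (cbox a b) \<and>
               norm (z - (L - F c)) < e)"
    using R by (intro exI[of _ "R + 1"]) auto
qed

text \<open>
  The values of \<open>\<phi>\<close> at the endpoints, where it may be singular, do not affect its integral; the
  primitive therefore extends continuously to the closed interval.
\<close>

lemma indefinite_integral_Ioo:
  fixes \<phi> :: "real \<Rightarrow> 'a :: banach"
  assumes "\<phi> integrable_on {a<..<b}" "continuous_on {a<..<b} \<phi>"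
  shows "continuous_on {a..b} (\<lambda>t. integral {a..t} \<phi>)"
    and "\<And>t. t \<in> {a<..<b} \<Longrightarrow> ((\<lambda>t. integral {a..t} \<phi>) has_vector_derivative \<phi> t) (at t)"
proof -
  have int: "\<phi> integrable_on {a..b}" using assms by (simp add: integrable_on_Icc_iff_Ioo)
  thus "continuous_on {a..b} (\<lambda>t. integral {a..t} \<phi>)"
    by (rule indefinite_integral_continuous_1)
  fix t assume t: "t \<in> {a<..<b}"
  have eq: "{a..b} - {a, b} = {a<..<b}" by auto
  have "((\<lambda>t. integral {a..t} \<phi>) has_vector_derivative \<phi> t) (at t within {a..b} - {a, b})"
    using t assms(2) unfolding eq
    by (intro integral_has_vector_derivative_continuous_at[OF int, of t "{a, b}", unfolded eq])
       (auto simp: continuous_on_eq_continuous_within)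
  thus "((\<lambda>t. integral {a..t} \<phi>) has_vector_derivative \<phi> t) (at t)"
    unfolding eq using t at_within_open[of t "{a<..<b}"] by simp
qed

text \<open>
  The product \<open>\<Phi> * g\<close> is continuous on the closed interval and a primitive of
  \<open>\<Phi> * g' + \<phi> * g\<close> in its interior. As \<open>\<Phi> * g'\<close> is continuous, the second summand is
  integrable by subtraction: existence of the integral is part of the conclusion.
\<close>

lemma has_integral_by_parts_conditional:
  fixes \<phi> g g' :: "real \<Rightarrow> complex"
  assumes \<phi>: "\<phi> integrable_on {a<..<b}" "continuous_on {a<..<b} \<phi>" and "a \<le> b"
    and g: "\<And>t. t \<in> {a..b} \<Longrightarrow> (g has_vector_derivative g' t) (at t)"
    and g': "continuous_on {a..b} g'"
  defines "\<Phi> \<equiv> \<lambda>t. integral {a..t} \<phi>"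
  shows "((\<lambda>t. \<phi> t * g t) has_integral (\<Phi> b * g b - integral {a..b} (\<lambda>t. \<Phi> t * g' t))) {a<..<b}"
proof -
  note \<Phi> = indefinite_integral_Ioo[OF \<phi>, folded \<Phi>_def]
  have contg: "continuous_on {a..b} g"
    using g by (meson continuous_at_imp_continuous_on has_vector_derivative_continuous)
  have "((\<lambda>t. \<Phi> t * g' t + \<phi> t * g t) has_integral (\<Phi> b * g b - \<Phi> a * g a)) {a..b}"
    using \<open>a \<le> b\<close> g
    by (intro fundamental_theorem_of_calculus_interior continuous_intros \<Phi> contg
          has_vector_derivative_mult) auto
  moreover have "((\<lambda>t. \<Phi> t * g' t) has_integral integral {a..b} (\<lambda>t. \<Phi> t * g' t)) {a..b}"
    by (intro integrable_integral integrable_continuous_real continuous_intros \<Phi> g')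
  ultimately have "((\<lambda>t. \<Phi> t * g' t + \<phi> t * g t - \<Phi> t * g' t) has_integral
      (\<Phi> b * g b - \<Phi> a * g a - integral {a..b} (\<lambda>t. \<Phi> t * g' t))) {a..b}"
    by (rule has_integral_diff)
  thus ?thesis by (simp add: \<Phi>_def has_integral_Icc_iff_Ioo)
qed

text \<open>
  The primitive of \<open>\<phi>\<close> composed with \<open>s\<close> is a primitive of the transformed integrand. The
  fundamental theorem of calculus then covers conditionally convergent integrals as well.
\<close>

lemma has_integral_substitution_Ioo:
  fixes \<phi> :: "real \<Rightarrow> complex"
  assumes \<phi>: "\<phi> integrable_on {a<..<b}" "continuous_on {a<..<b} \<phi>"
    and "c \<le> d" and s: "continuous_on {c..d} s" "s c = a" "s d = b"
    and s_in: "\<And>x. x \<in> {c<..<d} \<Longrightarrow> s x \<in> {a<..<b}"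
    and s': "\<And>x. x \<in> {c<..<d} \<Longrightarrow> (s has_real_derivative s' x) (at x)"
  shows "((\<lambda>x. of_real (s' x) * \<phi> (s x)) has_integral integral {a<..<b} \<phi>) {c<..<d}"
proof -
  define \<Phi> where "\<Phi> = (\<lambda>t. integral {a..t} \<phi>)"
  note \<Phi> = indefinite_integral_Ioo[OF \<phi>, folded \<Phi>_def]
  have "s x \<in> {a..b}" if x: "x \<in> {c..d}" for x
  proof (cases "c < d")
    case True
    have "a < b" using s_in[of "(c + d) / 2"] True by auto
    thus ?thesis using s_in[of x] x s by (cases "x = c \<or> x = d") auto
  next
    case False
    hence "x = c" "c = d" using x \<open>c \<le> d\<close> by auto
    thus ?thesis using s by auto
  qed
  hence "continuous_on {c..d} (\<lambda>x. \<Phi> (s x))"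
    by (intro continuous_on_compose2[OF \<Phi>(1) s(1)]) auto
  moreover have "((\<lambda>x. \<Phi> (s x)) has_vector_derivative of_real (s' x) * \<phi> (s x)) (at x)"
    if x: "x \<in> {c<..<d}" for x
    using vector_diff_chain_at[OF s'[OF x, unfolded has_real_derivative_iff_has_vector_derivative]
            \<Phi>(2)[OF s_in[OF x]]]
    by (simp add: o_def scaleR_conv_of_real)
  ultimately have "((\<lambda>x. of_real (s' x) * \<phi> (s x)) has_integral (\<Phi> (s d) - \<Phi> (s c))) {c..d}"
    using \<open>c \<le> d\<close> by (intro fundamental_theorem_of_calculus_interior) auto
  thus ?thesis
    by (simp add: s \<Phi>_def has_integral_Icc_iff_Ioo integral_open_interval_real)
qed

text \<open>
  The analogue for a half-line, whose end at infinity corresponds to the endpoint \<open>b\<close>.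
\<close>

lemma has_integral_substitution_Ioi:
  fixes \<phi> :: "real \<Rightarrow> complex"
  assumes \<phi>: "\<phi> integrable_on {a<..<b}" "continuous_on {a<..<b} \<phi>" and "a < b"
    and s: "continuous_on {c..} s" "s c = a" "(s \<longlongrightarrow> b) at_top"
    and s_in: "\<And>x. x > c \<Longrightarrow> s x \<in> {a<..<b}"
    and s': "\<And>x. x > c \<Longrightarrow> (s has_real_derivative s' x) (at x)"
  shows "((\<lambda>x. of_real (s' x) * \<phi> (s x)) has_integral integral {a<..<b} \<phi>) {c<..}"
proof -
  define \<Phi> where "\<Phi> = (\<lambda>t. integral {a..t} \<phi>)"
  note \<Phi> = indefinite_integral_Ioo[OF \<phi>, folded \<Phi>_def]
  have in': "s x \<in> {a..b}" if "x \<ge> c" for x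
    using s_in[of x] that s(2) \<open>a < b\<close> by (cases "x = c") auto
  hence cont: "continuous_on {c..} (\<lambda>x. \<Phi> (s x))"
    by (intro continuous_on_compose2[OF \<Phi>(1) s(1)]) auto
  have "(\<Phi> \<longlongrightarrow> \<Phi> b) (at b within {a..b})"
    using \<Phi>(1) \<open>a < b\<close> by (auto simp: continuous_on_def)
  moreover have "eventually (\<lambda>x. s x \<in> {a..b} \<and> s x \<noteq> b) at_top"
    using eventually_gt_at_top[of c] by eventually_elim (use s_in in force)
  hence "filterlim s (at b within {a..b}) at_top"
    using s(3) by (auto simp: filterlim_at elim: eventually_mono)
  ultimately have lim: "((\<lambda>x. \<Phi> (s x)) \<longlongrightarrow> \<Phi> b) at_top"
    by (rule filterlim_compose)
  have deriv: "((\<lambda>x. \<Phi> (s x)) has_vector_derivative of_real (s' x) * \<phi> (s x)) (at x)"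
    if x: "x > c" for x
    using vector_diff_chain_at[OF s'[OF x, unfolded has_real_derivative_iff_has_vector_derivative]
            \<Phi>(2)[OF s_in[OF x]]]
    by (simp add: o_def scaleR_conv_of_real)
  have "((\<lambda>x. of_real (s' x) * \<phi> (s x)) has_integral (\<Phi> b - \<Phi> (s c))) {c<..}"
    using has_integral_Ioi_FTC[OF cont deriv lim] by simp
  thus ?thesis by (simp add: s \<Phi>_def integral_open_interval_real)
qed

section \<open>The Euler kernel on the cut plane\<close>

lemma cut_plane_altdef: "cut_plane = {z. 1 - z \<notin> \<real>\<^sub>\<le>\<^sub>0}"
proof -
  have "z \<in> cut_plane \<longleftrightarrow> 1 - z \<notin> \<real>\<^sub>\<le>\<^sub>0" for z
  proof -
    have "\<bar>Arg (1 - z)\<bar> < pi \<longleftrightarrow> Arg (1 - z) \<noteq> pi"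
      using Arg_bounded[of "1 - z"] by auto
    thus ?thesis
      by (auto simp: cut_plane_def Arg_eq_pi complex_nonpos_Reals_iff complex_eq_iff)
  qed
  thus ?thesis by blast
qed

text \<open>
  The cut plane is star-shaped about the origin. This makes it connected, and it keeps the base
  \<open>1 - z t\<close> of the Euler kernel away from the branch cut of the power.
\<close>

lemma one_minus_mult_notin_nonpos_Reals:
  assumes "z \<in> cut_plane" "t \<in> {0..1}"
  shows "1 - z * of_real t \<notin> \<real>\<^sub>\<le>\<^sub>0"
proof
  assume "1 - z * of_real t \<in> \<real>\<^sub>\<le>\<^sub>0"
  hence *: "1 \<le> Re z * t" "Im z * t = 0" by (auto simp: complex_nonpos_Reals_iff)
  hence "t > 0" using assms by (cases "t = 0") auto
  have "Re z \<ge> 1"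
  proof (rule ccontr)
    assume "\<not> Re z \<ge> 1"
    hence "Re z * t < 1 * t" using \<open>t > 0\<close> by (intro mult_strict_right_mono) auto
    thus False using * assms by auto
  qed
  thus False using * \<open>t > 0\<close> assms by (auto simp: cut_plane_altdef complex_nonpos_Reals_iff)
qed

lemma open_cut_plane: "open cut_plane"
proof -
  have "cut_plane = (\<lambda>z. 1 - z) -` (- \<real>\<^sub>\<le>\<^sub>0)" by (auto simp: cut_plane_altdef)
  moreover have "open ((\<lambda>z::complex. 1 - z) -` (- \<real>\<^sub>\<le>\<^sub>0))"
    by (intro open_vimage continuous_intros) auto
  ultimately show ?thesis by simp
qed

lemma connected_cut_plane: "connected cut_plane"
proof (rule starlike_imp_connected)
  have "closed_segment 0 z \<subseteq> cut_plane" if "z \<in> cut_plane" for z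
    using one_minus_mult_notin_nonpos_Reals[OF that]
    by (auto simp: closed_segment_def cut_plane_altdef scaleR_conv_of_real mult.commute)
  moreover have "0 \<in> cut_plane" by (simp add: cut_plane_altdef)
  ultimately show "starlike cut_plane" unfolding starlike_def by blast
qed

lemma unit_ball_subset_cut_plane: "ball 0 1 \<subseteq> cut_plane"
proof
  fix z :: complex assume "z \<in> ball 0 1"
  thus "z \<in> cut_plane" using complex_Re_le_cmod[of z]
    by (auto simp: cut_plane_altdef complex_nonpos_Reals_iff)
qed

lemma continuous_on_kernel:
  "continuous_on (cut_plane \<times> {0..1}) (\<lambda>(z, t). (1 - z * of_real t) powr s)"
proof -
  have "continuous_on (cut_plane \<times> {0..1})
          (\<lambda>x. exp (s * Ln (1 - fst x * of_real (snd x))))"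
    using one_minus_mult_notin_nonpos_Reals by (intro continuous_intros) auto
  thus ?thesis
  proof (rule continuous_on_eq)
    fix x :: "complex \<times> real" assume "x \<in> cut_plane \<times> {0..1}"
    hence "1 - fst x * of_real (snd x) \<notin> \<real>\<^sub>\<le>\<^sub>0"
      by (intro one_minus_mult_notin_nonpos_Reals) auto
    hence "1 - fst x * of_real (snd x) \<noteq> 0" by (metis nonpos_Reals_zero_I)
    thus "exp (s * Ln (1 - fst x * of_real (snd x))) =
            (case x of (z, t) \<Rightarrow> (1 - z * of_real t) powr s)"
      by (cases x) (simp add: powr_def)
  qed
qed

lemma continuous_on_kernel_t:
  assumes "z \<in> cut_plane"
  shows "continuous_on {0..1} (\<lambda>t::real. (1 - z * of_real t) powr s)"
proof -
  have "continuous_on {0..1} (\<lambda>t. (z, t :: real))" by (intro continuous_intros)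
  hence "continuous_on {0..1} (\<lambda>t. case (z, t) of (z, t) \<Rightarrow> (1 - z * of_real t) powr s)"
    by (rule continuous_on_compose2[OF continuous_on_kernel]) (use assms in auto)
  thus ?thesis by simp
qed

lemma kernel_has_vector_derivative:
  assumes "z \<in> cut_plane" "t \<in> {0..1}"
  shows "((\<lambda>t. (1 - z * of_real t) powr (- a)) has_vector_derivative
            a * z * (1 - z * of_real t) powr (- a - 1)) (at t)"
proof -
  have "((\<lambda>w. (1 - z * w) powr (- a)) has_field_derivative
           a * z * (1 - z * of_real t) powr (- a - 1)) (at (of_real t))"
    using one_minus_mult_notin_nonpos_Reals[OF assms]
    by (auto intro!: derivative_eq_intros)
  from has_vector_derivative_real_field[OF this] show ?thesis by simp
qed

lemma binomial_series_pochhammer: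
  fixes a w :: complex
  assumes "norm w < 1"
  shows "(\<lambda>n. pochhammer a n / fact n * w ^ n) sums (1 - w) powr (- a)"
proof -
  have "((- a) gchoose n) * (- w) ^ n = pochhammer a n / fact n * w ^ n" for n
  proof -
    have "((- a) gchoose n) * (- w) ^ n = pochhammer a n / fact n * ((- 1) ^ n * (- w) ^ n)"
      by (simp add: gbinomial_pochhammer)
    also have "(- 1) ^ n * (- w) ^ n = w ^ n"
      by (simp flip: power_mult_distrib)
    finally show ?thesis .
  qed
  thus ?thesis using gen_binomial_complex[of "- w" "- a"] assms by simp
qed

text \<open>
  Since \<open>\<bar>z t\<bar> \<le> \<bar>z\<bar>\<close>, the norms of the terms at \<open>z\<close> form a majorant, and they are
  summable because the series still converges at some larger radius \<open>r < 1\<close>.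
\<close>

lemma uniform_limit_binomial_series:
  fixes a z :: complex
  assumes "norm z < 1"
  shows "uniform_limit {0..1} (\<lambda>N t. \<Sum>n<N. pochhammer a n / fact n * (z * of_real t) ^ n)
           (\<lambda>t. (1 - z * of_real t) powr (- a)) sequentially"
proof -
  let ?c = "\<lambda>n. pochhammer a n / fact n :: complex"
  have le: "norm (z * of_real t) \<le> norm z" if "t \<in> {0..1::real}" for t
    using that by (auto simp: norm_mult intro!: mult_left_le)
  obtain r where r: "norm z < r" "r < 1" using assms dense by blast
  hence "r > 0" using norm_ge_zero[of z] by linarith
  hence "norm (of_real r :: complex) < 1" using r by simp
  hence "summable (\<lambda>n. ?c n * of_real r ^ n)"
    using binomial_series_pochhammer sums_summable by blast
  hence "summable (\<lambda>n. norm (?c n * z ^ n))"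
    by (rule powser_insidea) (use r \<open>r > 0\<close> in auto)
  hence "uniform_limit {0..1} (\<lambda>N t. \<Sum>n<N. ?c n * (z * of_real t) ^ n)
           (\<lambda>t. \<Sum>n. ?c n * (z * of_real t) ^ n) sequentially"
  proof (intro Weierstrass_m_test)
    fix n :: nat and t :: real assume t: "t \<in> {0..1}"
    show "norm (?c n * (z * of_real t) ^ n) \<le> norm (?c n * z ^ n)"
      unfolding norm_mult[of "?c n"] norm_power[of _ n]
      by (intro mult_left_mono power_mono le t) auto
  qed
  moreover have "(\<Sum>n. ?c n * (z * of_real t) ^ n) = (1 - z * of_real t) powr (- a)"
    if "t \<in> {0..1}" for t :: real
    using binomial_series_pochhammer[of "z * of_real t" a] le[OF that] assms
    by (simp add: sums_iff)
  ultimately show ?thesis by (simp add: uniform_limit_iff)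
qed

text \<open>
  The identity \<open>(n + 1) (a)\<^sub>n\<^sub>+\<^sub>1 / (n + 1)! = a (a + 1)\<^sub>n / n!\<close> shows that the derivative is again a
  partial sum of a binomial series, with parameter \<open>a + 1\<close>. Hence
  \<open>uniform_limit_binomial_series\<close> also yields the uniform convergence of the derivatives.
\<close>

lemma binomial_partial_sum_has_vector_derivative:
  fixes a z :: complex
  shows "((\<lambda>t. \<Sum>n<Suc N. pochhammer a n / fact n * (z * of_real t) ^ n) has_vector_derivative
            a * z * (\<Sum>n<N. pochhammer (a + 1) n / fact n * (z * of_real t) ^ n)) (at t)"
proof -
  have coeff: "pochhammer a (Suc n) / fact (Suc n) * of_nat (Suc n) = a * (pochhammer (a + 1) n / fact n)"
    for n
  proof -
    have "(of_nat (Suc n) :: complex) \<noteq> 0" by (simp only: of_nat_eq_0_iff)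
    thus ?thesis unfolding pochhammer_rec fact_Suc of_nat_mult by (simp add: divide_simps)
  qed
  have "((\<lambda>w. \<Sum>n<N. pochhammer a (Suc n) / fact (Suc n) * (z * w) ^ Suc n) has_field_derivative
           (\<Sum>n<N. pochhammer a (Suc n) / fact (Suc n) * (of_nat (Suc n) * (z * of_real t) ^ n * z)))
           (at (of_real t))"
    by (rule DERIV_sum) (auto intro!: derivative_eq_intros simp del: power_Suc)
  also have "(\<Sum>n<N. pochhammer a (Suc n) / fact (Suc n) * (of_nat (Suc n) * (z * of_real t) ^ n * z)) =
               a * z * (\<Sum>n<N. pochhammer (a + 1) n / fact n * (z * of_real t) ^ n)"
    unfolding sum_distrib_left
  proof (rule sum.cong)
    fix n
    have "pochhammer a (Suc n) / fact (Suc n) * (of_nat (Suc n) * (z * of_real t) ^ n * z) =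
           (pochhammer a (Suc n) / fact (Suc n) * of_nat (Suc n)) * ((z * of_real t) ^ n * z)"
      by (simp only: mult.assoc)
    thus "pochhammer a (Suc n) / fact (Suc n) * (of_nat (Suc n) * (z * of_real t) ^ n * z) =
            a * z * (pochhammer (a + 1) n / fact n * (z * of_real t) ^ n)"
      unfolding coeff by (simp add: mult_ac)
  qed simp
  finally have "((\<lambda>w. 1 + (\<Sum>n<N. pochhammer a (Suc n) / fact (Suc n) * (z * w) ^ Suc n))
      has_field_derivative a * z * (\<Sum>n<N. pochhammer (a + 1) n / fact n * (z * of_real t) ^ n))
      (at (of_real t))"
    using DERIV_add[OF DERIV_const[of 1]] by fastforce
  from has_vector_derivative_real_field[OF this] show ?thesis
    by (simp only: sum.lessThan_Suc_shift) simp
qed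

section \<open>The Euler transform of a conditionally integrable function\<close>

text \<open>
  By parts, the integral of \<open>\<phi>\<close> against the \<open>N\<close>-th partial sum \<open>P\<close> of the kernel involves only the
  value of \<open>P\<close> at 1 and the integral of the continuous function \<open>\<Phi>\<close> against the derivative \<open>Q\<close>
  of \<open>P\<close>. Both converge, the latter because \<open>Q\<close> converges uniformly to the derivative of the
  kernel.
\<close>

lemma integral_kernel_sums:
  fixes \<phi> :: "real \<Rightarrow> complex"
  assumes \<phi>: "\<phi> integrable_on {0<..<1}" "continuous_on {0<..<1} \<phi>" and z: "norm z < 1"
  shows "(\<lambda>n. pochhammer a n / fact n * z ^ n * integral {0<..<1} (\<lambda>t. of_real t ^ n * \<phi> t)) sums
           integral {0<..<1} (\<lambda>t. \<phi> t * (1 - z * of_real t) powr (- a))"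
proof -
  define \<Phi> where "\<Phi> = (\<lambda>t. integral {0..t} \<phi>)"
  define P where "P = (\<lambda>N (t::real). \<Sum>n<N. pochhammer a n / fact n * (z * of_real t) ^ n)"
  define Q where "Q = (\<lambda>N (t::real). a * z * (\<Sum>n<N. pochhammer (a + 1) n / fact n * (z * of_real t) ^ n))"
  define k where "k = (\<lambda>t::real. (1 - z * of_real t) powr (- a))"
  define k' where "k' = (\<lambda>t::real. a * z * (1 - z * of_real t) powr (- a - 1))"
  have by_parts: "((\<lambda>t. \<phi> t * g t) has_integral
                     (\<Phi> 1 * g 1 - integral {0..1} (\<lambda>t. \<Phi> t * g' t))) {0<..<1}"
    if "\<And>t. t \<in> {0..1} \<Longrightarrow> (g has_vector_derivative g' t) (at t)" "continuous_on {0..1} g'"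
    for g g' :: "real \<Rightarrow> complex"
    using has_integral_by_parts_conditional[OF \<phi> _ that] by (simp add: \<Phi>_def)
  have cp: "z \<in> cut_plane" using z unit_ball_subset_cut_plane by auto
  have cont\<Phi>: "continuous_on {0..1} \<Phi>"
    using indefinite_integral_Ioo(1)[OF \<phi>] by (simp add: \<Phi>_def)
  have contk': "continuous_on {0..1} k'"
    unfolding k'_def by (intro continuous_intros continuous_on_kernel_t cp)
  have int_k: "((\<lambda>t. \<phi> t * k t) has_integral (\<Phi> 1 * k 1 - integral {0..1} (\<lambda>t. \<Phi> t * k' t))) {0<..<1}"
    using kernel_has_vector_derivative[OF cp, of _ a] contk'
    by (intro by_parts) (auto simp: k_def k'_def)
  have int_P: "((\<lambda>t. \<phi> t * P (Suc N) t) has_integral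
                 (\<Phi> 1 * P (Suc N) 1 - integral {0..1} (\<lambda>t. \<Phi> t * Q N t))) {0<..<1}" for N
    unfolding P_def Q_def
    by (intro by_parts binomial_partial_sum_has_vector_derivative continuous_intros) auto
  have int_power: "((\<lambda>t. of_real t ^ n * \<phi> t) has_integral
                      integral {0<..<1} (\<lambda>t. of_real t ^ n * \<phi> t)) {0<..<1}" for n
  proof -
    have "((\<lambda>t. of_real t ^ n :: complex) has_vector_derivative
             of_nat n * of_real t ^ (n - 1)) (at t)"
      for t :: real
      by (rule has_vector_derivative_real_field) (auto intro!: derivative_eq_intros)
    hence "((\<lambda>t. \<phi> t * of_real t ^ n) has_integral
        (\<Phi> 1 * of_real 1 ^ n - integral {0..1} (\<lambda>t. \<Phi> t * (of_nat n * of_real t ^ (n - 1))))) {0<..<1}"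
      by (intro by_parts) (auto intro!: continuous_intros)
    thus ?thesis by (auto simp: mult.commute integrable_on_def intro: integrable_integral)
  qed
  have partial: "(\<Sum>n<Suc N. pochhammer a n / fact n * z ^ n * integral {0<..<1} (\<lambda>t. of_real t ^ n * \<phi> t)) =
          \<Phi> 1 * P (Suc N) 1 - integral {0..1} (\<lambda>t. \<Phi> t * Q N t)" for N
  proof (rule has_integral_unique)
    show "((\<lambda>t. \<phi> t * P (Suc N) t) has_integral
                 (\<Phi> 1 * P (Suc N) 1 - integral {0..1} (\<lambda>t. \<Phi> t * Q N t))) {0<..<1}"
      by (rule int_P)
    have "((\<lambda>t. \<Sum>n<Suc N. pochhammer a n / fact n * z ^ n * (of_real t ^ n * \<phi> t)) has_integral
      (\<Sum>n<Suc N. pochhammer a n / fact n * z ^ n * integral {0<..<1} (\<lambda>t. of_real t ^ n * \<phi> t)))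
      {0<..<1}"
      by (intro has_integral_sum has_integral_mult_right int_power) auto
    also have "(\<lambda>t. \<Sum>n<Suc N. pochhammer a n / fact n * z ^ n * (of_real t ^ n * \<phi> t)) =
                 (\<lambda>t. \<phi> t * P (Suc N) t)"
      unfolding P_def sum_distrib_left by (intro ext sum.cong) (simp_all add: power_mult_distrib)
    finally show "((\<lambda>t. \<phi> t * P (Suc N) t) has_integral
      (\<Sum>n<Suc N. pochhammer a n / fact n * z ^ n * integral {0<..<1} (\<lambda>t. of_real t ^ n * \<phi> t)))
      {0<..<1}" .
  qed
  have "(\<lambda>N. P N 1) \<longlonglongrightarrow> k 1"
    using binomial_series_pochhammer[OF z, of a] by (simp add: P_def k_def sums_def)
  hence limP: "(\<lambda>N. P (Suc N) 1) \<longlonglongrightarrow> k 1" by (rule LIMSEQ_Suc)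
  have bounded: "bounded (f ` {0..1})" if "continuous_on {0..1} f" for f :: "real \<Rightarrow> complex"
    using that by (intro compact_imp_bounded compact_continuous_image) auto
  have "uniform_limit {0..1} Q k' sequentially"
    using uniform_limit_binomial_series[OF z, of "a + 1"] unfolding Q_def k'_def
    by (intro uniform_limit_intros) simp_all
  hence "uniform_limit {0..1} (\<lambda>N t. \<Phi> t * Q N t) (\<lambda>t. \<Phi> t * k' t) sequentially"
    by (intro uniform_lim_mult uniform_limit_const bounded cont\<Phi> contk')
  moreover have "continuous_on {0..1} (\<lambda>t. \<Phi> t * Q N t)" for N
    unfolding Q_def by (intro continuous_intros cont\<Phi>)
  moreover have "sequentially \<noteq> bot" by simp
  ultimately obtain I J where IJ: "\<And>N. ((\<lambda>t. \<Phi> t * Q N t) has_integral I N) {0..1}"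
      "((\<lambda>t. \<Phi> t * k' t) has_integral J) {0..1}" "I \<longlonglongrightarrow> J"
    by (rule uniform_limit_integral) blast
  have "I = (\<lambda>N. integral {0..1} (\<lambda>t. \<Phi> t * Q N t))" "J = integral {0..1} (\<lambda>t. \<Phi> t * k' t)"
    by (intro ext integral_unique[symmetric] IJ)+
  with IJ(3) have "(\<lambda>N. integral {0..1} (\<lambda>t. \<Phi> t * Q N t)) \<longlonglongrightarrow> integral {0..1} (\<lambda>t. \<Phi> t * k' t)"
    by simp
  hence "(\<lambda>N. \<Sum>n<Suc N. pochhammer a n / fact n * z ^ n * integral {0<..<1} (\<lambda>t. of_real t ^ n * \<phi> t))
           \<longlonglongrightarrow> \<Phi> 1 * k 1 - integral {0..1} (\<lambda>t. \<Phi> t * k' t)"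
    unfolding partial by (intro tendsto_intros limP)
  hence "(\<lambda>n. pochhammer a n / fact n * z ^ n * integral {0<..<1} (\<lambda>t. of_real t ^ n * \<phi> t)) sums
           (\<Phi> 1 * k 1 - integral {0..1} (\<lambda>t. \<Phi> t * k' t))"
    unfolding sums_def by (rule LIMSEQ_imp_Suc)
  thus ?thesis using int_k by (simp add: integral_unique k_def)
qed

lemma has_integral_kernel:
  fixes \<phi> :: "real \<Rightarrow> complex"
  assumes \<phi>: "\<phi> integrable_on {0<..<1}" "continuous_on {0<..<1} \<phi>" and z: "z \<in> cut_plane"
  defines "\<Phi> \<equiv> \<lambda>t. integral {0..t} \<phi>"
  shows "((\<lambda>t. \<phi> t * (1 - z * of_real t) powr (- a)) has_integral
           (\<Phi> 1 * (1 - z) powr (- a) -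
              a * z * integral {0..1} (\<lambda>t. \<Phi> t * (1 - z * of_real t) powr (- a - 1)))) {0<..<1}"
proof -
  have "((\<lambda>t. \<phi> t * (1 - z * of_real t) powr (- a)) has_integral
           (\<Phi> 1 * (1 - z * of_real 1) powr (- a) -
              integral {0..1} (\<lambda>t. \<Phi> t * (a * z * (1 - z * of_real t) powr (- a - 1))))) {0<..<1}"
    unfolding \<Phi>_def using kernel_has_vector_derivative[OF z, of _ a]
    by (intro has_integral_by_parts_conditional \<phi>)
       (auto intro!: continuous_on_mult continuous_on_const continuous_on_kernel_t z)
  also have "(\<lambda>t. \<Phi> t * (a * z * (1 - z * of_real t) powr (- a - 1))) =
             (\<lambda>t. a * z * (\<Phi> t * (1 - z * of_real t) powr (- a - 1)))"
    by (simp add: mult_ac)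
  finally show ?thesis by simp
qed

text \<open>
  In the form given by \<open>has_integral_kernel\<close>, the parameter \<open>z\<close> occurs only in elementary factors and
  in the integral \<open>J\<close> of a function that is continuous in \<open>t\<close> and holomorphic in \<open>z\<close>. The
  Leibniz rule is for convex domains, which suffices because holomorphy can be tested on balls.
\<close>

lemma integral_kernel_holomorphic:
  fixes \<phi> :: "real \<Rightarrow> complex"
  assumes \<phi>: "\<phi> integrable_on {0<..<1}" "continuous_on {0<..<1} \<phi>"
  shows "(\<lambda>z. integral {0<..<1} (\<lambda>t. \<phi> t * (1 - z * of_real t) powr (- a))) holomorphic_on cut_plane"
proof -
  define \<Phi> where "\<Phi> = (\<lambda>t. integral {0..t} \<phi>)"
  have cont\<Phi>: "continuous_on {0..1} \<Phi>"
    using indefinite_integral_Ioo(1)[OF \<phi>] by (simp add: \<Phi>_def)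
  define J where "J = (\<lambda>z. integral {0..1} (\<lambda>t. \<Phi> t * (1 - z * of_real t) powr (- a - 1)))"
  have "J holomorphic_on U" if U: "U \<subseteq> cut_plane" "convex U" for U
    unfolding J_def box_real(2)[symmetric]
  proof (rule leibniz_rule_holomorphic[where
          fx = "\<lambda>z t. \<Phi> t * ((a + 1) * of_real t * (1 - z * of_real t) powr (- a - 2))"])
    fix z t assume zt: "z \<in> U" "t \<in> cbox (0::real) 1"
    hence "1 - z * of_real t \<notin> \<real>\<^sub>\<le>\<^sub>0" using U by (intro one_minus_mult_notin_nonpos_Reals) auto
    thus "((\<lambda>z. \<Phi> t * (1 - z * of_real t) powr (- a - 1)) has_field_derivative
            \<Phi> t * ((a + 1) * of_real t * (1 - z * of_real t) powr (- a - 2))) (at z within U)"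
      by (auto intro!: derivative_eq_intros simp: algebra_simps)
  next
    fix z assume "z \<in> U"
    thus "(\<lambda>t. \<Phi> t * (1 - z * of_real t) powr (- a - 1)) integrable_on cbox 0 1"
      using U by (auto intro!: integrable_continuous_real continuous_on_mult cont\<Phi> continuous_on_kernel_t)
  next
    have "continuous_on (U \<times> {0..1}) (\<lambda>x. \<Phi> (snd x) * ((a + 1) * of_real (snd x) *
            (case x of (z, t) \<Rightarrow> (1 - z * of_real t) powr (- a - 2))))"
      using U
      by (intro continuous_on_mult continuous_on_compose2[OF cont\<Phi>]
                continuous_on_subset[OF continuous_on_kernel] continuous_intros) auto
    thus "continuous_on (U \<times> cbox 0 1) (\<lambda>(z, t). \<Phi> t * ((a + 1) * of_real t *
            (1 - z * of_real t) powr (- a - 2)))"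
      by (simp add: case_prod_unfold)
  qed (use U in auto)
  hence J: "J holomorphic_on cut_plane"
    using open_cut_plane
    by (metis holomorphic_on_open open_contains_ball convex_ball centre_in_ball open_ball)
  have "(\<lambda>z. \<Phi> 1 * (1 - z) powr (- a) - a * z * J z) holomorphic_on cut_plane"
    by (intro holomorphic_intros J) (auto simp: cut_plane_altdef)
  thus ?thesis
  proof (rule holomorphic_transform)
    fix z assume "z \<in> cut_plane"
    from integral_unique[OF has_integral_kernel[OF \<phi> this, of a]]
    show "\<Phi> 1 * (1 - z) powr (- a) - a * z * J z =
            integral {0<..<1} (\<lambda>t. \<phi> t * (1 - z * of_real t) powr (- a))"
      by (simp add: \<Phi>_def J_def)
  qed
qed

section \<open>Euler integrals for the Psi-Gauss function\<close>

text \<open>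
  Within the disc the function is its series; beyond it the identity theorem makes the
  continuation unique, so that any candidate \<open>F\<close> is the one picked by the definite description.
\<close>

lemma Psi_Gauss_eqI:
  assumes hol: "F holomorphic_on cut_plane"
    and sums: "\<And>\<zeta>. norm \<zeta> < 1 \<Longrightarrow> Psi_Gauss_term \<alpha> \<beta> p a b c \<zeta> sums F \<zeta>"
    and z: "z \<in> cut_plane"
  shows "Psi_Gauss \<alpha> \<beta> p a b c z = F z"
proof (cases "norm z < 1")
  case True
  thus ?thesis using sums[of z] by (simp add: Psi_Gauss_def sums_iff)
next
  case False
  have "(THE w. \<exists>g. g holomorphic_on cut_plane \<and>
           (\<forall>\<zeta>. norm \<zeta> < 1 \<longrightarrow> Psi_Gauss_term \<alpha> \<beta> p a b c \<zeta> sums g \<zeta>) \<and> w = g z) = F z"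
  proof (rule the_equality)
    show "\<exists>g. g holomorphic_on cut_plane \<and>
           (\<forall>\<zeta>. norm \<zeta> < 1 \<longrightarrow> Psi_Gauss_term \<alpha> \<beta> p a b c \<zeta> sums g \<zeta>) \<and> F z = g z"
      using hol sums by blast
  next
    fix w
    assume "\<exists>g. g holomorphic_on cut_plane \<and>
           (\<forall>\<zeta>. norm \<zeta> < 1 \<longrightarrow> Psi_Gauss_term \<alpha> \<beta> p a b c \<zeta> sums g \<zeta>) \<and> w = g z"
    then obtain g where g: "g holomorphic_on cut_plane"
      "\<And>\<zeta>. norm \<zeta> < 1 \<Longrightarrow> Psi_Gauss_term \<alpha> \<beta> p a b c \<zeta> sums g \<zeta>" "w = g z" by blast
    have "g z = F z"
    proof (rule analytic_continuation_open[of "ball 0 1" cut_plane g F])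
      fix \<zeta> :: complex assume "\<zeta> \<in> ball 0 1"
      thus "g \<zeta> = F \<zeta>" using g(2)[of \<zeta>] sums[of \<zeta>] by (simp add: sums_iff)
    qed (use g hol z open_cut_plane connected_cut_plane unit_ball_subset_cut_plane in auto)
    thus "w = F z" using g by simp
  qed
  thus ?thesis using False by (simp add: Psi_Gauss_def)
qed

lemma Psi_Beta_shift:
  "Psi_Beta \<alpha> \<beta> p (x + of_nat n) y =
     integral {0<..<1} (\<lambda>t. of_real t ^ n * Psi_Beta_integrand \<alpha> \<beta> p x y t)"
  unfolding Psi_Beta_def
proof (rule integral_cong)
  fix t :: real assume "t \<in> {0<..<1}"
  hence "of_real t powr (x + of_nat n - 1) = (of_real t powr (x - 1) * of_real t ^ n :: complex)"
    using powr_add[of "of_real t" "x - 1" "of_nat n"] by (simp add: algebra_simps powr_nat)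
  thus "Psi_Beta_integrand \<alpha> \<beta> p (x + of_nat n) y t =
          of_real t ^ n * Psi_Beta_integrand \<alpha> \<beta> p x y t"
    by (simp add: Psi_Beta_integrand_def mult_ac)
qed

text \<open>
  This continuity is what makes the primitive of the integrand differentiable at every interior
  point.
\<close>

lemma continuous_on_Psi_Beta_integrand:
  assumes "Re \<alpha> > -1"
  shows "continuous_on {0<..<1} (Psi_Beta_integrand \<alpha> \<beta> p x y)"
proof -
  have "continuous_on {0<..<1} (\<lambda>t::real. - (p / of_real (t * (1 - t))))"
    by (intro continuous_intros) auto
  hence "continuous_on {0<..<1} (\<lambda>t::real. Wright \<alpha> \<beta> (- (p / of_real (t * (1 - t)))))"
    by (rule continuous_on_compose2[OF continuous_on_Wright[OF assms, of UNIV]]) auto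
  thus ?thesis
    unfolding Psi_Beta_integrand_def by (intro continuous_intros) auto
qed

lemma Psi_Gauss_Euler_integral:
  assumes "Re \<alpha> > -1" "z \<in> cut_plane" "Psi_Beta_exists \<alpha> \<beta> p b (c - b)"
  shows "Psi_Gauss \<alpha> \<beta> p a b c z = 1 / Beta b (c - b) *
           integral {0<..<1} (\<lambda>t. Psi_Beta_integrand \<alpha> \<beta> p b (c - b) t * (1 - z * of_real t) powr (- a))"
proof (rule Psi_Gauss_eqI)
  define \<phi> where "\<phi> = Psi_Beta_integrand \<alpha> \<beta> p b (c - b)"
  have \<phi>: "\<phi> integrable_on {0<..<1}" "continuous_on {0<..<1} \<phi>"
    using assms continuous_on_Psi_Beta_integrand by (auto simp: Psi_Beta_exists_def \<phi>_def)
  show "(\<lambda>z. 1 / Beta b (c - b) *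
           integral {0<..<1} (\<lambda>t. Psi_Beta_integrand \<alpha> \<beta> p b (c - b) t * (1 - z * of_real t) powr (- a)))
        holomorphic_on cut_plane"
    using integral_kernel_holomorphic[OF \<phi>, of a] unfolding \<phi>_def
    by (rule holomorphic_on_mult[OF holomorphic_on_const])
  fix \<zeta> :: complex assume "norm \<zeta> < 1"
  from sums_mult[OF integral_kernel_sums[OF \<phi> this, of a], of "1 / Beta b (c - b)"]
  show "Psi_Gauss_term \<alpha> \<beta> p a b c \<zeta> sums (1 / Beta b (c - b) *
           integral {0<..<1} (\<lambda>t. Psi_Beta_integrand \<alpha> \<beta> p b (c - b) t * (1 - \<zeta> * of_real t) powr (- a)))"
    unfolding \<phi>_def by (simp add: Psi_Gauss_term_def[abs_def] Psi_Beta_shift mult_ac)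
qed fact

text \<open>
  Powers of positive reals obey all the usual laws of exponents, which become additive in this
  exponential form.
\<close>

lemma powr_of_real_pos: "x > 0 \<Longrightarrow> of_real x powr s = exp (s * of_real (ln x))"
  for s :: complex
  by (simp add: powr_def Ln_of_real)

theorem theorem3p1:
  fixes \<alpha> \<beta> a b c z p :: complex
  assumes "Re \<alpha> > -1"
    and "Re p > 0 \<or> p = 0"
    and "z \<noteq> 1" and "\<bar>Arg (1 - z)\<bar> < pi"
    and "Re c > Re b" and "Re b > 0"
    and "Psi_Beta_exists \<alpha> \<beta> p b (c - b)"
  shows
    "(let f = (\<lambda>t::real. of_real t powr (b - 1) * of_real (1 - t) powr (c - b - 1) *
                 Wright \<alpha> \<beta> (- (p / of_real (t * (1 - t)))) * (1 - z * of_real t) powr (- a))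
      in f integrable_on {0<..<1} \<and>
         Psi_Gauss \<alpha> \<beta> p a b c z = 1 / Beta b (c - b) * integral {0<..<1} f) \<and>
     (let g = (\<lambda>u::real. of_real u powr (b - 1) * of_real (1 + u) powr (a - c) *
                 (1 + of_real u * (1 - z)) powr (- a) *
                 Wright \<alpha> \<beta> (- 2 * p - p * of_real (u + 1 / u)))
      in g integrable_on {0<..} \<and>
         Psi_Gauss \<alpha> \<beta> p a b c z = 1 / Beta b (c - b) * integral {0<..} g) \<and>
     (let h = (\<lambda>\<theta>::real. of_real (sin \<theta>) powr (2 * b - 1) *
                 of_real (cos \<theta>) powr (2 * c - 2 * b - 1) *
                 (1 - z * of_real ((sin \<theta>)\<^sup>2)) powr (- a) *
                 Wright \<alpha> \<beta> (- (p / of_real ((sin \<theta>)\<^sup>2 * (cos \<theta>)\<^sup>2))))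
      in h integrable_on {0<..<pi / 2} \<and>
         Psi_Gauss \<alpha> \<beta> p a b c z = 2 / Beta b (c - b) * integral {0<..<pi / 2} h)"
proof -
  define f where "f = (\<lambda>t::real. of_real t powr (b - 1) * of_real (1 - t) powr (c - b - 1) *
                 Wright \<alpha> \<beta> (- (p / of_real (t * (1 - t)))) * (1 - z * of_real t) powr (- a))"
  define g where "g = (\<lambda>u::real. of_real u powr (b - 1) * of_real (1 + u) powr (a - c) *
                 (1 + of_real u * (1 - z)) powr (- a) *
                 Wright \<alpha> \<beta> (- 2 * p - p * of_real (u + 1 / u)))"
  define h where "h = (\<lambda>\<theta>::real. of_real (sin \<theta>) powr (2 * b - 1) *
                 of_real (cos \<theta>) powr (2 * c - 2 * b - 1) *
                 (1 - z * of_real ((sin \<theta>)\<^sup>2)) powr (- a) *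
                 Wright \<alpha> \<beta> (- (p / of_real ((sin \<theta>)\<^sup>2 * (cos \<theta>)\<^sup>2))))"
  define \<phi> where "\<phi> = Psi_Beta_integrand \<alpha> \<beta> p b (c - b)"
  have z: "z \<in> cut_plane" using assms by (simp add: cut_plane_def)
  have \<phi>: "\<phi> integrable_on {0<..<1}" "continuous_on {0<..<1} \<phi>"
    using assms continuous_on_Psi_Beta_integrand by (auto simp: Psi_Beta_exists_def \<phi>_def)
  have f_eq: "f = (\<lambda>t. \<phi> t * (1 - z * of_real t) powr (- a))"
    by (simp add: f_def \<phi>_def Psi_Beta_integrand_def fun_eq_iff)
  have f_int: "f integrable_on {0<..<1}"
    unfolding f_eq using has_integral_kernel[OF \<phi> z] by blast
  have f_cont: "continuous_on {0<..<1} f"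
    unfolding f_eq
    by (intro continuous_on_mult \<phi> continuous_on_subset[OF continuous_on_kernel_t[OF z]]) auto
  have Gauss: "Psi_Gauss \<alpha> \<beta> p a b c z = 1 / Beta b (c - b) * integral {0<..<1} f"
    using Psi_Gauss_Euler_integral[OF assms(1) z assms(7)] by (simp add: f_eq \<phi>_def)

  have square_powr: "of_real (x\<^sup>2) powr s * of_real x = (of_real x powr (2 * s + 1) :: complex)"
    if "x > 0" for x :: real and s
  proof -
    have "of_real (x\<^sup>2) powr s * of_real x = exp (s * of_real (ln (x\<^sup>2))) * exp (of_real (ln x))"
      using that powr_of_real_pos[of "x\<^sup>2" s] by (simp add: exp_of_real)
    also have "ln (x\<^sup>2) = 2 * ln x" using that by (simp add: ln_realpow)
    also have "exp (s * of_real (2 * ln x)) * exp (of_real (ln x)) =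
                 (exp ((2 * s + 1) * of_real (ln x)) :: complex)"
      by (simp add: algebra_simps flip: exp_add)
    also have "\<dots> = of_real x powr (2 * s + 1)" using that by (simp only: powr_of_real_pos)
    finally show ?thesis .
  qed

  have "((\<lambda>u. of_real (1 / (1 + u)\<^sup>2) * f (u / (1 + u))) has_integral integral {0<..<1} f) {0<..}"
  proof (rule has_integral_substitution_Ioi[OF f_int f_cont])
    show "continuous_on {0..} (\<lambda>u::real. u / (1 + u))" by (intro continuous_intros) auto
    show "((\<lambda>u::real. u / (1 + u)) \<longlongrightarrow> 1) at_top" by real_asymp
    show "((\<lambda>u. u / (1 + u)) has_real_derivative 1 / (1 + u)\<^sup>2) (at u)" if "u > 0" for u :: real
      using that by (auto intro!: derivative_eq_intros simp: field_simps power2_eq_square)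
  qed auto
  also have "?this \<longleftrightarrow> (g has_integral integral {0<..<1} f) {0<..}"
  proof (rule has_integral_cong)
    fix u :: real assume "u \<in> {0<..}"
    hence u: "u > 0" by simp
    have "1 - u / (1 + u) = 1 / (1 + u)" using u by (simp add: field_simps)
    have W: "- (p / of_real (u / (1 + u) * (1 - u / (1 + u)))) = - 2 * p - p * of_real (u + 1 / u)"
    proof -
      have "u / (1 + u) * (1 - u / (1 + u)) = 1 / (2 + (u + 1 / u))"
      proof -
        have "2 + (u + 1 / u) = (1 + u)\<^sup>2 / u"
          using u by (simp add: field_simps power2_eq_square)
        thus ?thesis
          by (simp add: \<open>1 - u / (1 + u) = 1 / (1 + u)\<close> power2_eq_square)
      qed
      hence "p / of_real (u / (1 + u) * (1 - u / (1 + u))) = p * of_real (2 + (u + 1 / u))"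
        by (simp only: of_real_divide) simp
      thus ?thesis by (simp add: algebra_simps)
    qed
    have "1 - z * of_real (u / (1 + u)) = of_real (1 / (1 + u)) * (1 + of_real u * (1 - z))"
    proof -
      have "(1 + of_real u :: complex) \<noteq> 0"
        using u by (metis of_real_1 of_real_add of_real_eq_0_iff add_pos_pos less_irrefl zero_less_one)
      thus ?thesis by (simp add: field_simps)
    qed
    hence K: "(1 - z * of_real (u / (1 + u))) powr (- a) =
                of_real (1 / (1 + u)) powr (- a) * (1 + of_real u * (1 - z)) powr (- a)"
      using powr_times_real_left[of "of_real (1 / (1 + u))" "1 + of_real u * (1 - z)" "- a"] u
      by (simp only: Reals_of_real Re_complex_of_real zero_le_divide_1_iff)
    have E: "of_real (1 / (1 + u)\<^sup>2) * (of_real (u / (1 + u)) powr (b - 1) *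
             of_real (1 - u / (1 + u)) powr (c - b - 1)) * of_real (1 / (1 + u)) powr (- a) =
           of_real u powr (b - 1) * of_real (1 + u) powr (a - c)"
    proof -
      have "of_real (1 / (1 + u)\<^sup>2) = (exp (- 2 * of_real (ln (1 + u))) :: complex)"
      proof -
        have "1 / (1 + u)\<^sup>2 = exp (- (2 * ln (1 + u)))"
          using u by (simp add: exp_minus exp_double field_simps)
        thus ?thesis by (simp flip: exp_of_real)
      qed
      moreover have "of_real (u / (1 + u)) powr s = exp (s * of_real (ln u - ln (1 + u)))"
                    "of_real (1 / (1 + u)) powr s = exp (s * of_real (- ln (1 + u)))"
                    "of_real u powr s = exp (s * of_real (ln u))"
                    "of_real (1 + u) powr s = exp (s * of_real (ln (1 + u)))" for s :: complex
        using u powr_of_real_pos[of "u / (1 + u)" s] powr_of_real_pos[of "1 / (1 + u)" s]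
              powr_of_real_pos[of u s] powr_of_real_pos[of "1 + u" s]
        by (simp_all only: ln_div) simp_all
      ultimately show ?thesis
        by (simp only: \<open>1 - u / (1 + u) = 1 / (1 + u)\<close> exp_add[symmetric])
           (simp add: algebra_simps)
    qed
    show "of_real (1 / (1 + u)\<^sup>2) * f (u / (1 + u)) = g u"
      unfolding f_def g_def W K E[symmetric] by (simp only: mult_ac)
  qed
  finally have g: "(g has_integral integral {0<..<1} f) {0<..}" .

  have "((\<lambda>\<theta>. of_real (2 * sin \<theta> * cos \<theta>) * f ((sin \<theta>)\<^sup>2)) has_integral integral {0<..<1} f) {0<..<pi/2}"
  proof (rule has_integral_substitution_Ioo[OF f_int f_cont])
    show "(sin \<theta>)\<^sup>2 \<in> {0<..<1}" if "\<theta> \<in> {0<..<pi/2}" for \<theta> :: real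
    proof -
      have "sin \<theta> > 0" "cos \<theta> > 0" using that by (auto intro!: sin_gt_zero cos_gt_zero)
      hence "(sin \<theta>)\<^sup>2 > 0" "(cos \<theta>)\<^sup>2 > 0" by simp_all
      thus ?thesis using sin_cos_squared_add[of \<theta>] unfolding greaterThanLessThan_iff by linarith
    qed
    show "((\<lambda>\<theta>. (sin \<theta>)\<^sup>2) has_real_derivative 2 * sin \<theta> * cos \<theta>) (at \<theta>)" for \<theta> :: real
      by (auto intro!: derivative_eq_intros)
  qed (auto intro!: continuous_intros)
  also have "?this \<longleftrightarrow> ((\<lambda>\<theta>. 2 * h \<theta>) has_integral integral {0<..<1} f) {0<..<pi/2}"
  proof (rule has_integral_cong)
    fix \<theta> :: real assume "\<theta> \<in> {0<..<pi/2}"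
    hence pos: "sin \<theta> > 0" "cos \<theta> > 0" by (auto intro!: sin_gt_zero cos_gt_zero)
    have cos2: "1 - (sin \<theta>)\<^sup>2 = (cos \<theta>)\<^sup>2" by (simp add: cos_squared_eq)
    have s: "of_real ((sin \<theta>)\<^sup>2) powr (b - 1) * of_real (sin \<theta>) = (of_real (sin \<theta>) powr (2 * b - 1) :: complex)"
      using square_powr[OF pos(1), of "b - 1"] by (simp add: algebra_simps)
    have c: "of_real ((cos \<theta>)\<^sup>2) powr (c - b - 1) * of_real (cos \<theta>) =
               (of_real (cos \<theta>) powr (2 * c - 2 * b - 1) :: complex)"
      using square_powr[OF pos(2), of "c - b - 1"] by (simp add: algebra_simps)
    show "of_real (2 * sin \<theta> * cos \<theta>) * f ((sin \<theta>)\<^sup>2) = 2 * h \<theta>"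
      unfolding f_def h_def cos2 s[symmetric] c[symmetric] of_real_mult[of "2 * sin \<theta>"] of_real_mult[of 2]
      by (simp only: of_real_numeral mult_ac)
  qed
  finally have "((\<lambda>\<theta>. 1 / 2 * (2 * h \<theta>)) has_integral 1 / 2 * integral {0<..<1} f) {0<..<pi/2}"
    by (rule has_integral_mult_right)
  hence h: "(h has_integral 1 / 2 * integral {0<..<1} f) {0<..<pi/2}" by simp

  show ?thesis
    unfolding Let_def f_def[symmetric] g_def[symmetric] h_def[symmetric]
    using f_int Gauss g h by (auto simp: integral_unique intro: has_integral_integrable)
qed

end
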